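(* Let $n \geq 4$ be an integer. Then the square $Q_n^2$ of the hypercube $Q_n$ is an automorphic graph if and only if $n$ is an even integer.
   Context: All graphs are finite, simple and undirected. The hypercube $Q_n$ is the graph with vertex set $\{0,1\}^n$ in which two $n$-tuples are adjacent if and only if they differ in precisely one coordinate. For a graph $\Gamma=(V,E)$, the square $\Gamma^2$ is the simple graph with vertex set $V$ in which two distinct vertices are adjacent if and only if their distance in $\Gamma$ is at most two. A graph $\Gamma$ is distance-transitive if for all vertices $u,v,x,y$ of $\Gamma$ with $d(u,v)=d(x,y)$ (graph distance in $\Gamma$) there is an automorphism $\pi$ of $\Gamma$ such that $\pi(u)=x$ and $\pi(v)=y$. A block in the action of a group $G$ on a set $X$ is a subset $B\subseteq X$ such that $B\cap g(B)\in\{B,\emptyset\}$ for each $g\in G$. If $G$ is transitive on $X$, the action is primitive if the only blocks are those of cardinality $0$, $1$ or $|X|$. The line graph $L(\Delta)$ of a graph $\Delta$ has the edges of $\Delta$ as vertices, two of them being adjacent whenever the corresponding (distinct) edges of $\Delta$ have a common vertex; a graph is a line graph if it is isomorphic to $L(\Delta)$ for some graph $\Delta$. An automorphic graph is a distance-transitive graph whose automorphism group acts primitively on its vertices, and which is not a complete graph or a line graph. *)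

theory Defs
  imports "HOL-Algebra.Group_Action" "HOL-Library.Extended_Nat"
begin

section \<open>Finite simple graphs\<close>

record 'a graph =
  verts :: "'a set"
  edges :: "'a set set"

definition simple_graph :: "'a graph \<Rightarrow> bool"
  where "simple_graph G \<longleftrightarrow>
    finite (verts G) \<and> edges G \<subseteq> {e. e \<subseteq> verts G \<and> card e = 2}"

definition adj :: "'a graph \<Rightarrow> 'a \<Rightarrow> 'a \<Rightarrow> bool"
  where "adj G u v \<longleftrightarrow> {u, v} \<in> edges G"

definition complete_graph :: "'a graph \<Rightarrow> bool"
  where "complete_graph G \<longleftrightarrow> (\<forall>u\<in>verts G. \<forall>v\<in>verts G. u \<noteq> v \<longrightarrow> adj G u v)"

definition graph_iso :: "'a graph \<Rightarrow> 'b graph \<Rightarrow> ('a \<Rightarrow> 'b) \<Rightarrow> bool"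
  where "graph_iso G H f \<longleftrightarrow> bij_betw f (verts G) (verts H) \<and>
    (\<forall>u\<in>verts G. \<forall>v\<in>verts G. adj G u v \<longleftrightarrow> adj H (f u) (f v))"

definition isomorphic :: "'a graph \<Rightarrow> 'b graph \<Rightarrow> bool"
  where "isomorphic G H \<longleftrightarrow> (\<exists>f. graph_iso G H f)"


section \<open>Distance and square\<close>

text \<open>A walk is the list of its vertices, so its length as a walk is one less than its length
  as a list. The distance is \<^term>\<open>\<infinity>\<close> if there is no walk (the infimum of the empty set).\<close>

definition walk :: "'a graph \<Rightarrow> 'a list \<Rightarrow> bool"
  where "walk G p \<longleftrightarrow> p \<noteq> [] \<and> set p \<subseteq> verts G \<and> successively (adj G) p"

definition gdist :: "'a graph \<Rightarrow> 'a \<Rightarrow> 'a \<Rightarrow> enat"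
  where "gdist G u v = (INF p\<in>{p. walk G p \<and> hd p = u \<and> last p = v}. enat (length p - 1))"

definition graph_square :: "'a graph \<Rightarrow> 'a graph"
  where "graph_square G =
    \<lparr>verts = verts G,
     edges = {{u, v} |u v. u \<in> verts G \<and> v \<in> verts G \<and> u \<noteq> v \<and> gdist G u v \<le> 2}\<rparr>"

lemma simple_graph_square: "simple_graph G \<Longrightarrow> simple_graph (graph_square G)"
  by (auto simp: simple_graph_def graph_square_def card_2_iff)


section \<open>The hypercube\<close>

text \<open>The coordinates $0$ and $1$ are represented by the truth values.\<close>

definition hypercube :: "nat \<Rightarrow> bool list graph"
  where "hypercube n =
    \<lparr>verts = {x. length x = n},
     edges = {{x, y} |x y. length x = n \<and> length y = n \<and> card {i. i < n \<and> x ! i \<noteq> y ! i} = 1}\<rparr>"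

lemma simple_graph_hypercube: "simple_graph (hypercube n)"
proof -
  have "finite {x :: bool list. length x = n}"
    using finite_lists_length_eq[of "UNIV :: bool set" n] by simp
  moreover have "card {x, y} = 2" if "card {i. i < n \<and> x ! i \<noteq> y ! i} = 1" for x y :: "bool list"
    using that by (cases "x = y") auto
  ultimately show ?thesis
    by (auto simp: simple_graph_def hypercube_def)
qed


section \<open>Automorphisms, distance-transitivity and primitivity\<close>

definition graph_auts :: "'a graph \<Rightarrow> ('a \<Rightarrow> 'a) set"
  where "graph_auts G = {f \<in> Bij (verts G). graph_iso G G f}"

definition GraphAut :: "'a graph \<Rightarrow> ('a \<Rightarrow> 'a) monoid"
  where "GraphAut G = BijGroup (verts G) \<lparr>carrier := graph_auts G\<rparr>"

definition distance_transitive :: "'a graph \<Rightarrow> bool"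
  where "distance_transitive G \<longleftrightarrow>
    (\<forall>u\<in>verts G. \<forall>v\<in>verts G. \<forall>x\<in>verts G. \<forall>y\<in>verts G.
      gdist G u v = gdist G x y \<longrightarrow> (\<exists>f\<in>graph_auts G. f u = x \<and> f v = y))"

definition block :: "('g, 'm) monoid_scheme \<Rightarrow> 'b set \<Rightarrow> ('g \<Rightarrow> 'b \<Rightarrow> 'b) \<Rightarrow> 'b set \<Rightarrow> bool"
  where "block G E \<phi> B \<longleftrightarrow> B \<subseteq> E \<and> (\<forall>g\<in>carrier G. B \<inter> \<phi> g ` B \<in> {B, {}})"

text \<open>Only meant for a finite set \<^term>\<open>E\<close>, since \<^const>\<open>card\<close> is \<open>0\<close> on infinite sets.\<close>

definition primitive_action :: "('g, 'm) monoid_scheme \<Rightarrow> 'b set \<Rightarrow> ('g \<Rightarrow> 'b \<Rightarrow> 'b) \<Rightarrow> bool"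
  where "primitive_action G E \<phi> \<longleftrightarrow>
    transitive_action G E \<phi> \<and> (\<forall>B. block G E \<phi> B \<longrightarrow> card B \<in> {0, 1, card E})"

lemma subgroup_graph_auts: "subgroup (graph_auts G) (BijGroup (verts G))"
proof (rule subgroup.intro)
  let ?V = "verts G"
  show "graph_auts G \<subseteq> carrier (BijGroup ?V)"
    by (auto simp: graph_auts_def BijGroup_def)
  show "\<one>\<^bsub>BijGroup ?V\<^esub> \<in> graph_auts G"
    by (auto simp: graph_auts_def BijGroup_def id_Bij graph_iso_def bij_betw_def inj_on_def)
  show "f \<otimes>\<^bsub>BijGroup ?V\<^esub> g \<in> graph_auts G" if "f \<in> graph_auts G" "g \<in> graph_auts G" for f g
  proof -
    have "f \<in> Bij ?V" "g \<in> Bij ?V" using that by (auto simp: graph_auts_def)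
    moreover from this have "compose ?V f g \<in> Bij ?V" by (rule compose_Bij)
    moreover have "graph_iso G G (compose ?V f g)"
      using that calculation Bij_imp_funcset[OF \<open>g \<in> Bij ?V\<close>]
      by (auto simp: graph_auts_def graph_iso_def Bij_def compose_eq Pi_iff)
    ultimately show ?thesis by (simp add: graph_auts_def BijGroup_def)
  qed
  show "inv\<^bsub>BijGroup ?V\<^esub> f \<in> graph_auts G" if "f \<in> graph_auts G" for f
  proof -
    have f: "f \<in> Bij ?V" "graph_iso G G f" using that by (auto simp: graph_auts_def)
    have b: "(\<lambda>x\<in>?V. inv_into ?V f x) \<in> Bij ?V" using f(1) by (rule restrict_inv_into_Bij)
    have "f (inv_into ?V f x) = x" "inv_into ?V f x \<in> ?V" if "x \<in> ?V" for x
      using that f(1) by (auto simp: Bij_def bij_betw_def f_inv_into_f inv_into_into)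
    then have "graph_iso G G (\<lambda>x\<in>?V. inv_into ?V f x)"
      using f(2) b by (auto simp: graph_iso_def Bij_def)
    with b f(1) show ?thesis by (simp add: graph_auts_def inv_BijGroup)
  qed
qed

lemma group_action_GraphAut: "group_action (GraphAut G) (verts G) (\<lambda>f. f)"
proof -
  interpret B: group "BijGroup (verts G)" by (rule group_BijGroup)
  have "group (GraphAut G)"
    unfolding GraphAut_def by (rule B.subgroup_imp_group[OF subgroup_graph_auts])
  moreover have "(\<lambda>f. f) \<in> hom (GraphAut G) (BijGroup (verts G))"
    using subgroup.subset[OF subgroup_graph_auts[of G]] by (auto simp: hom_def GraphAut_def)
  ultimately show ?thesis
    by (auto simp: group_action_def group_hom_def group_hom_axioms_def B.is_group)
qed


section \<open>Line graphs\<close>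

definition line_graph :: "'a graph \<Rightarrow> 'a set graph"
  where "line_graph D =
    \<lparr>verts = edges D,
     edges = {{e, f} |e f. e \<in> edges D \<and> f \<in> edges D \<and> e \<noteq> f \<and> e \<inter> f \<noteq> {}}\<rparr>"

lemma simple_graph_line_graph: "simple_graph D \<Longrightarrow> simple_graph (line_graph D)"
  unfolding simple_graph_def line_graph_def
  by (auto simp: card_2_iff intro: finite_subset[of _ "Pow (verts D)"])

lemma adj_line_graph_iff:
  "adj (line_graph D) e f \<longleftrightarrow> e \<in> edges D \<and> f \<in> edges D \<and> e \<noteq> f \<and> e \<inter> f \<noteq> {}"
  by (auto simp: adj_def line_graph_def doubleton_eq_iff)

text \<open>A definition cannot quantify over the type of the vertices of the root graph. As every
  finite graph is isomorphic to one whose vertices are natural numbers, taking these as vertices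
  is no restriction, see \<open>is_line_graphI\<close> below.\<close>

definition is_line_graph :: "'a graph \<Rightarrow> bool"
  where "is_line_graph G \<longleftrightarrow>
    (\<exists>D :: nat graph. simple_graph D \<and> isomorphic G (line_graph D))"

lemma is_line_graphI:
  fixes D :: "'b graph"
  assumes D: "simple_graph D" and iso: "isomorphic G (line_graph D)"
  shows "is_line_graph G"
proof -
  have fin: "finite (verts D)" and E: "\<And>e. e \<in> edges D \<Longrightarrow> e \<subseteq> verts D \<and> card e = 2"
    using D by (auto simp: simple_graph_def)
  obtain h :: "'b \<Rightarrow> nat" where h: "inj_on h (verts D)"
    using finite_imp_inj_to_nat_seg[OF fin] by blast
  define D' where "D' = \<lparr>verts = h ` verts D, edges = (`) h ` edges D\<rparr>"
  have "card (h ` e) = 2" if "e \<in> edges D" for e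
    using E[OF that] h by (metis card_image inj_on_subset)
  then have "simple_graph D'"
    using fin E by (fastforce simp: simple_graph_def D'_def)
  have inj: "h ` e = h ` f \<longleftrightarrow> e = f" and disj: "h ` e \<inter> h ` f = {} \<longleftrightarrow> e \<inter> f = {}"
    if "e \<in> edges D" "f \<in> edges D" for e f
    using E[OF that(1)] E[OF that(2)] h
    by (simp_all add: inj_on_image_eq_iff inj_on_image_Int[symmetric])
  have "graph_iso (line_graph D) (line_graph D') ((`) h)"
    unfolding graph_iso_def
  proof (intro conjI ballI)
    show "bij_betw ((`) h) (verts (line_graph D)) (verts (line_graph D'))"
      by (simp add: line_graph_def D'_def bij_betw_def inj_on_def inj)
  next
    fix e f assume "e \<in> verts (line_graph D)" "f \<in> verts (line_graph D)"
    then have "e \<in> edges D" "f \<in> edges D" by (simp_all add: line_graph_def)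
    then show "adj (line_graph D) e f \<longleftrightarrow> adj (line_graph D') (h ` e) (h ` f)"
      unfolding adj_line_graph_iff inj[OF \<open>e \<in> edges D\<close> \<open>f \<in> edges D\<close>]
        disj[OF \<open>e \<in> edges D\<close> \<open>f \<in> edges D\<close>]
      by (simp add: D'_def)
  qed
  moreover obtain g where "graph_iso G (line_graph D) g"
    using iso by (auto simp: isomorphic_def)
  ultimately have "graph_iso G (line_graph D') ((`) h \<circ> g)"
    by (auto simp: graph_iso_def intro: bij_betw_trans dest: bij_betwE)
  with \<open>simple_graph D'\<close> show ?thesis
    by (auto simp: is_line_graph_def isomorphic_def)
qed


section \<open>Automorphic graphs\<close>

definition automorphic_graph :: "'a graph \<Rightarrow> bool"
  where "automorphic_graph G \<longleftrightarrow>
    simple_graph G \<and> distance_transitive G \<and>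
    primitive_action (GraphAut G) (verts G) (\<lambda>f. f) \<and>
    \<not> complete_graph G \<and> \<not> is_line_graph G"

end

theory Submission
  imports Defs
begin

text \<open>Appending a parity bit turns words of length \<open>n\<close> into even subsets of \<open>{0..n}\<close>, that is, the
  square of the hypercube into the halved cube of dimension \<open>n + 1\<close>: adjacency means that the
  symmetric difference has two elements, and the distance is half the size of the symmetric
  difference. Translations and permutations of the \<open>n + 1\<close> coordinates give distance-transitivity.

  A block that contains two vertices at distance \<open>i > 0\<close> is closed under all steps of length \<open>i\<close>. If
  \<open>n\<close> is even, then \<open>2 * i \<le> n\<close>, so two sets of size \<open>2 * i\<close> can differ by an exchange of one
  element; hence a step of length 1 is composed of two steps of length \<open>i\<close>, and the block is
  everything. If \<open>n\<close> is odd, every vertex has a unique vertex at maximal distance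
  \<open>(n + 1) / 2\<close>, and such antipodal pairs are blocks.\<close>

section \<open>Distances in graphs\<close>

text \<open>Induction along the walk: by the triangle inequality, each edge raises \<open>d\<close>
  by at most 1. This is the lower bound in \<open>gdist_eqI\<close>.\<close>

lemma walk_dist_le:
  fixes d :: "'a \<Rightarrow> 'a \<Rightarrow> nat"
  assumes refl: "\<And>x. x \<in> verts G \<Longrightarrow> d x x = 0"
    and adj: "\<And>x y. x \<in> verts G \<Longrightarrow> y \<in> verts G \<Longrightarrow> adj G x y \<Longrightarrow> d x y \<le> 1"
    and tri: "\<And>x y z. x \<in> verts G \<Longrightarrow> y \<in> verts G \<Longrightarrow> z \<in> verts G \<Longrightarrow> d x z \<le> d x y + d y z"
    and "walk G p"
  shows "d (hd p) (last p) \<le> length p - 1"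
  using \<open>walk G p\<close>
proof (induction p rule: induct_list012)
  case (3 x y p)
  then have IH: "d y (last (y # p)) \<le> length p" and "x \<in> verts G" "y \<in> verts G" "adj G x y"
    "last (y # p) \<in> verts G"
    by (auto simp: walk_def)
  with adj[of x y] tri[of x y "last (y # p)"] show ?case
    by simp
qed (auto simp: walk_def refl)

text \<open>Computes distances both in the hypercube and in its square. Repeated use of
  \<open>step\<close> builds a walk of length \<open>d u v\<close>, while \<open>adj\<close> and
  \<open>tri\<close> rule out shorter ones.\<close>

lemma gdist_eqI:
  fixes d :: "'a \<Rightarrow> 'a \<Rightarrow> nat"
  assumes zero: "\<And>x y. x \<in> verts G \<Longrightarrow> y \<in> verts G \<Longrightarrow> d x y = 0 \<longleftrightarrow> x = y"
    and adj: "\<And>x y. x \<in> verts G \<Longrightarrow> y \<in> verts G \<Longrightarrow> adj G x y \<Longrightarrow> d x y \<le> 1"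
    and tri: "\<And>x y z. x \<in> verts G \<Longrightarrow> y \<in> verts G \<Longrightarrow> z \<in> verts G \<Longrightarrow> d x z \<le> d x y + d y z"
    and step: "\<And>x y k. x \<in> verts G \<Longrightarrow> y \<in> verts G \<Longrightarrow> d x y = Suc k \<Longrightarrow>
      \<exists>z\<in>verts G. adj G x z \<and> d z y = k"
    and "u \<in> verts G" "v \<in> verts G"
  shows "gdist G u v = enat (d u v)"
proof (rule antisym)
  have "\<exists>p. walk G p \<and> hd p = u \<and> last p = v \<and> length p = Suc (d u v)"
    using \<open>u \<in> verts G\<close>
  proof (induction "d u v" arbitrary: u)
    case 0
    then have "walk G [u] \<and> u = v"
      using zero \<open>v \<in> verts G\<close> by (auto simp: walk_def)
    then show ?case
      using "0.hyps" by (intro exI[of _ "[u]"]) auto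
  next
    case (Suc k)
    obtain z where z: "z \<in> verts G" "adj G u z" "d z v = k"
      using step[of u v k] Suc.prems Suc.hyps(2) \<open>v \<in> verts G\<close> by auto
    then obtain p where p: "walk G p" "hd p = z" "last p = v" "length p = Suc k"
      using Suc.hyps(1) by metis
    then have "walk G (u # p) \<and> last (u # p) = v"
      using z Suc.prems by (auto simp: walk_def successively_Cons)
    with p Suc.hyps(2) show ?case
      by (intro exI[of _ "u # p"]) auto
  qed
  then obtain p where "walk G p" "hd p = u" "last p = v" "length p = Suc (d u v)" by blast
  then show "gdist G u v \<le> enat (d u v)"
    unfolding gdist_def by (intro INF_lower2[of p]) auto
  show "enat (d u v) \<le> gdist G u v"
    unfolding gdist_def
  proof (rule INF_greatest)
    fix p assume "p \<in> {p. walk G p \<and> hd p = u \<and> last p = v}"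
    then show "enat (d u v) \<le> enat (length p - 1)"
      using walk_dist_le[of G d p] zero adj tri by auto
  qed
qed

text \<open>The image of a walk is a walk of the same length. Equality follows below by applying
  this to the inverse as well.\<close>

lemma gdist_graph_iso_le:
  assumes "graph_iso G H f"
  shows "gdist H (f u) (f v) \<le> gdist G u v"
  unfolding gdist_def[of G]
proof (rule INF_greatest)
  fix p assume p: "p \<in> {p. walk G p \<and> hd p = u \<and> last p = v}"
  then have set: "set p \<subseteq> verts G" and succ: "successively (adj G) p" and "p \<noteq> []"
    by (auto simp: walk_def)
  from succ have "successively (\<lambda>x y. adj H (f x) (f y)) p"
    by (rule successively_mono) (use assms set in \<open>auto simp: graph_iso_def\<close>)
  moreover have "f ` set p \<subseteq> verts H"
    using assms set by (auto simp: graph_iso_def bij_betw_def)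
  ultimately have "walk H (map f p)"
    using \<open>p \<noteq> []\<close> by (simp add: walk_def successively_map)
  with p show "gdist H (f u) (f v) \<le> enat (length p - 1)"
    unfolding gdist_def
    by (intro INF_lower2[of "map f p"]) (auto simp: walk_def hd_map last_map)
qed

lemma gdist_graph_iso:
  assumes "graph_iso G H f" "u \<in> verts G" "v \<in> verts G"
  shows "gdist H (f u) (f v) = gdist G u v"
proof (rule antisym[OF gdist_graph_iso_le[OF assms(1)]])
  let ?g = "inv_into (verts G) f"
  have bij: "bij_betw f (verts G) (verts H)"
    using assms(1) by (simp add: graph_iso_def)
  then have "graph_iso H G ?g"
    using assms(1) unfolding graph_iso_def
    by (auto simp: bij_betw_inv_into bij_betw_inv_into_right bij_betw_apply[OF bij_betw_inv_into])
  from gdist_graph_iso_le[OF this, of "f u" "f v"]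
  show "gdist G u v \<le> gdist H (f u) (f v)"
    using assms bij by (simp add: bij_betw_inv_into_left)
qed


section \<open>Blocks and line graphs\<close>

text \<open>Distance-transitivity gives an automorphism \<open>f\<close> with \<open>f w = u\<close>
  and \<open>f x = v\<close>. Then \<open>u\<close> lies in both \<open>B\<close> and its image, so
  the block property puts all of \<open>B\<close>, in particular \<open>v\<close>, into the image.
  Injectivity of \<open>f\<close> pulls \<open>v\<close> back to \<open>x\<close>.\<close>

lemma block_closed_gdist:
  assumes "distance_transitive G" and block: "block (GraphAut G) (verts G) (\<lambda>f. f) B"
    and "u \<in> B" "v \<in> B" "w \<in> B" "x \<in> verts G" "gdist G w x = gdist G u v"
  shows "x \<in> B"
proof -
  have "B \<subseteq> verts G"
    using block by (simp add: block_def)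
  then have "u \<in> verts G" "v \<in> verts G" "w \<in> verts G"
    using \<open>u \<in> B\<close> \<open>v \<in> B\<close> \<open>w \<in> B\<close> by auto
  then obtain f where f: "f \<in> graph_auts G" "f w = u" "f x = v"
    using assms(1) \<open>x \<in> verts G\<close> \<open>gdist G w x = gdist G u v\<close>
    unfolding distance_transitive_def by blast
  then have "B \<inter> f ` B \<in> {B, {}}"
    using block by (simp add: block_def GraphAut_def)
  then have "v \<in> f ` B"
    using f \<open>u \<in> B\<close> \<open>v \<in> B\<close> \<open>w \<in> B\<close> by auto
  moreover have "inj_on f (verts G)"
    using f by (auto simp: graph_auts_def Bij_def bij_betw_def)
  ultimately show ?thesis
    using f \<open>B \<subseteq> verts G\<close> \<open>x \<in> verts G\<close> by (auto simp: inj_on_def)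
qed

lemma gdist_self:
  assumes "x \<in> verts G"
  shows "gdist G x x = 0"
proof -
  have "gdist G x x \<le> enat (length [x] - 1)"
    unfolding gdist_def using assms by (intro INF_lower) (auto simp: walk_def)
  then show ?thesis by (simp add: zero_enat_def[symmetric])
qed

text \<open>Transitivity is the case of distance 0 in distance-transitivity.\<close>

lemma transitive_action_GraphAut:
  assumes "distance_transitive G"
  shows "transitive_action (GraphAut G) (verts G) (\<lambda>f. f)"
proof (rule transitive_action.intro[OF group_action_GraphAut], rule transitive_action_axioms.intro)
  fix x y assume xy: "x \<in> verts G" "y \<in> verts G"
  then have "gdist G x x = gdist G y y"
    by (simp add: gdist_self)
  with assms xy have "\<exists>f\<in>graph_auts G. f x = y \<and> f x = y"
    unfolding distance_transitive_def by blast
  then show "\<exists>f\<in>carrier (GraphAut G). f x = y"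
    by (simp add: GraphAut_def)
qed

text \<open>The neighbours of an edge \<open>{a, b}\<close> in a line graph are covered by the clique of the edges
  at \<open>a\<close> and the clique of the edges at \<open>b\<close>, so non-adjacency among them is a bipartite relation.\<close>

lemma not_is_line_graph_if_nonadj_pentagon:
  assumes verts: "v \<in> verts G" "x1 \<in> verts G" "x2 \<in> verts G" "x3 \<in> verts G" "x4 \<in> verts G" "x5 \<in> verts G"
    and nbrs: "adj G v x1" "adj G v x2" "adj G v x3" "adj G v x4" "adj G v x5"
    and nonadj: "\<not> adj G x1 x2" "\<not> adj G x2 x3" "\<not> adj G x3 x4" "\<not> adj G x4 x5" "\<not> adj G x5 x1"
    and distinct: "x1 \<noteq> x2" "x2 \<noteq> x3" "x3 \<noteq> x4" "x4 \<noteq> x5" "x5 \<noteq> x1"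
  shows "\<not> is_line_graph G"
proof
  assume "is_line_graph G"
  then obtain D :: "nat graph" and g where D: "simple_graph D" and g: "graph_iso G (line_graph D) g"
    by (auto simp: is_line_graph_def isomorphic_def)
  have edge: "g x \<in> edges D" if "x \<in> verts G" for x
    using g that by (auto simp: graph_iso_def bij_betw_def line_graph_def)
  obtain a b where ab: "g v = {a, b}"
    using D edge[OF verts(1)] by (auto simp: simple_graph_def card_2_iff)
  have meet: "a \<in> g x \<or> b \<in> g x" if "x \<in> verts G" "adj G v x" for x
    using g that verts(1) ab by (auto simp: graph_iso_def adj_line_graph_iff)
  have disjoint: "g x \<inter> g y = {}" if "x \<in> verts G" "y \<in> verts G" "\<not> adj G x y" "x \<noteq> y" for x y
  proof -
    have "g x \<noteq> g y"
      using g that by (auto simp: graph_iso_def bij_betw_def inj_on_def)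
    then show ?thesis
      using g that edge by (auto simp: graph_iso_def adj_line_graph_iff)
  qed
  \<comment> \<open>Disjointness of consecutive edges forces the endpoints \<open>a\<close> and
    \<open>b\<close> to alternate around a cycle of odd length 5, which is impossible.\<close>
  show False
    using meet[OF verts(2) nbrs(1)] meet[OF verts(3) nbrs(2)] meet[OF verts(4) nbrs(3)]
      meet[OF verts(5) nbrs(4)] meet[OF verts(6) nbrs(5)]
      disjoint[OF verts(2,3) nonadj(1) distinct(1)] disjoint[OF verts(3,4) nonadj(2) distinct(2)]
      disjoint[OF verts(4,5) nonadj(3) distinct(3)] disjoint[OF verts(5,6) nonadj(4) distinct(4)]
      disjoint[OF verts(6,2) nonadj(5) distinct(5)]
    by blast
qed


section \<open>Hamming distance and the square of the hypercube\<close>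

definition hamming :: "'a list \<Rightarrow> 'a list \<Rightarrow> nat"
  where "hamming x y = card {i. i < length x \<and> x ! i \<noteq> y ! i}"

lemma verts_hypercube [simp]: "verts (hypercube n) = {x. length x = n}"
  by (simp add: hypercube_def)

lemma hamming_commute: "length x = length y \<Longrightarrow> hamming x y = hamming y x"
  by (simp add: hamming_def eq_commute)

lemma hamming_eq_0_iff: "length x = length y \<Longrightarrow> hamming x y = 0 \<longleftrightarrow> x = y"
  by (auto simp: hamming_def list_eq_iff_nth_eq)

lemma hamming_triangle:
  assumes "length x = length y"
  shows "hamming x z \<le> hamming x y + hamming y z"
proof -
  have "hamming x z \<le> card ({i. i < length x \<and> x ! i \<noteq> y ! i} \<union> {i. i < length y \<and> y ! i \<noteq> z ! i})"
    unfolding hamming_def using assms by (intro card_mono) auto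
  also have "\<dots> \<le> hamming x y + hamming y z"
    unfolding hamming_def by (rule card_Un_le)
  finally show ?thesis .
qed

lemma adj_hypercube_iff:
  "adj (hypercube n) x y \<longleftrightarrow> length x = n \<and> length y = n \<and> hamming x y = 1"
proof -
  have "adj (hypercube n) x y \<longleftrightarrow>
      (\<exists>a b. {x, y} = {a, b} \<and> length a = n \<and> length b = n \<and> hamming a b = 1)"
    by (simp add: adj_def hypercube_def hamming_def cong: conj_cong)
  then show ?thesis
    by (auto simp: doubleton_eq_iff hamming_commute)
qed

lemma hamming_step:
  fixes x y :: "bool list"
  assumes "length x = length y" "hamming x y = Suc k"
  obtains z where "length z = length x" "hamming x z = 1" "hamming z y = k"
proof -
  let ?D = "{i. i < length x \<and> x ! i \<noteq> y ! i}"
  have "?D \<noteq> {}"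
    using assms(2) unfolding hamming_def by (metis card.empty nat.distinct(1))
  then obtain i where i: "i < length x" "x ! i \<noteq> y ! i" by blast
  let ?z = "x[i := y ! i]"
  have "{j. j < length x \<and> x ! j \<noteq> ?z ! j} = {i}" "{j. j < length ?z \<and> ?z ! j \<noteq> y ! j} = ?D - {i}"
    using i by (auto simp: nth_list_update)
  then have "hamming x ?z = 1" "hamming ?z y = k"
    using assms(2) i by (simp_all add: hamming_def)
  with that[of ?z] show thesis by simp
qed

lemma gdist_hypercube:
  assumes "length x = n" "length y = n"
  shows "gdist (hypercube n) x y = enat (hamming x y)"
  using assms
proof (intro gdist_eqI)
  show "\<exists>z\<in>verts (hypercube n). adj (hypercube n) x z \<and> hamming z y = k"
    if "x \<in> verts (hypercube n)" "y \<in> verts (hypercube n)" "hamming x y = Suc k" for x y k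
    using that hamming_step[of x y k] by (auto simp: adj_hypercube_iff)
qed (auto simp: adj_hypercube_iff hamming_eq_0_iff hamming_triangle)

lemma verts_graph_square [simp]: "verts (graph_square G) = verts G"
  by (simp add: graph_square_def)

lemma adj_square_hypercube_iff:
  "adj (graph_square (hypercube n)) x y \<longleftrightarrow>
    length x = n \<and> length y = n \<and> hamming x y \<in> {1, 2}"
proof -
  \<comment> \<open>An unordered edge can be written in two ways, so both orders of the distance
    occur until symmetry of \<open>hamming\<close> merges them.\<close>
  have "adj (graph_square (hypercube n)) x y \<longleftrightarrow>
    length x = n \<and> length y = n \<and> x \<noteq> y \<and>
    (gdist (hypercube n) x y \<le> 2 \<or> gdist (hypercube n) y x \<le> 2)"
    by (auto simp: adj_def graph_square_def doubleton_eq_iff)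
  also have "\<dots> \<longleftrightarrow> length x = n \<and> length y = n \<and> x \<noteq> y \<and> hamming x y \<le> 2"
    by (auto simp: gdist_hypercube hamming_commute numeral_eq_enat)
  also have "\<dots> \<longleftrightarrow> length x = n \<and> length y = n \<and> hamming x y \<in> {1, 2}"
    using hamming_eq_0_iff[of x y] by auto
  finally show ?thesis .
qed


section \<open>The square of the hypercube as a halved cube\<close>

definition even_subsets :: "'a set \<Rightarrow> 'a set set"
  where "even_subsets A = {S. S \<subseteq> A \<and> even (card S)}"

text \<open>Words are coded by their supports, so that translations and coordinate permutations of
  the halved cube become symmetric differences and images of sets.\<close>

definition parity_ext :: "bool list \<Rightarrow> nat set"
  where "parity_ext x =
    (let S = {i. i < length x \<and> x ! i} in if even (card S) then S else insert (length x) S)"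

text \<open>The additive form avoids truncated subtraction and lets the parity be read off
  directly.\<close>

lemma card_sym_diff:
  assumes "finite A" "finite B"
  shows "card (sym_diff A B) + 2 * card (A \<inter> B) = card A + card B"
proof -
  have "card A = card (A - B) + card (A \<inter> B)" "card B = card (B - A) + card (A \<inter> B)"
    using assms card_Int_Diff[of A B] card_Int_Diff[of B A] by (simp_all add: Int_commute)
  moreover have "card (sym_diff A B) = card (A - B) + card (B - A)"
    using assms by (intro card_Un_disjoint) auto
  ultimately show ?thesis by simp
qed

lemma even_card_sym_diff:
  "finite A \<Longrightarrow> finite B \<Longrightarrow> even (card (sym_diff A B)) \<longleftrightarrow> even (card A + card B)"
  by (metis card_sym_diff dvd_triv_left even_add)

lemma sym_diff_even_subsets:
  assumes "finite A" "S \<in> even_subsets A" "T \<in> even_subsets A"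
  shows "sym_diff S T \<in> even_subsets A"
proof -
  have "finite S" "finite T"
    using assms by (auto simp: even_subsets_def intro: finite_subset)
  with assms show ?thesis
    by (auto simp: even_subsets_def even_card_sym_diff)
qed

lemma parity_ext_less_iff: "i < length x \<Longrightarrow> i \<in> parity_ext x \<longleftrightarrow> x ! i"
  by (auto simp: parity_ext_def Let_def)

lemma parity_ext_in: "parity_ext x \<in> even_subsets {..length x}"
  by (auto simp: parity_ext_def Let_def even_subsets_def)

text \<open>The elements below \<open>n\<close> determine the word, whence injectivity. Once they
  are fixed, even cardinality decides whether \<open>n\<close> belongs to the set, whence
  surjectivity.\<close>

lemma bij_betw_parity_ext: "bij_betw parity_ext {x. length x = n} (even_subsets {..n})"
proof (intro bij_betw_imageI equalityI subsetI)
  show "inj_on parity_ext {x. length x = n}"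
  proof (rule inj_onI, rule nth_equalityI)
    fix x y i assume "x \<in> {x. length x = n}" "y \<in> {x. length x = n}" "i < length x"
      "parity_ext x = parity_ext y"
    then show "x ! i = y ! i"
      using parity_ext_less_iff[of i x] parity_ext_less_iff[of i y] by simp
  qed simp
  show "S \<in> even_subsets {..n}" if "S \<in> parity_ext ` {x. length x = n}" for S
    using that parity_ext_in by auto
  show "S \<in> parity_ext ` {x. length x = n}" if S: "S \<in> even_subsets {..n}" for S
  proof
    let ?x = "map (\<lambda>i. i \<in> S) [0..<n]"
    have fin: "finite S"
      using S by (auto simp: even_subsets_def intro: finite_subset)
    have diff: "{i. i < length ?x \<and> ?x ! i} = S - {n}"
      using S by (auto simp: even_subsets_def)
    have "even (card S)"
      using S by (simp add: even_subsets_def)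
    have ext: "parity_ext ?x = (if even (card (S - {n})) then S - {n} else insert n (S - {n}))"
      unfolding parity_ext_def Let_def diff by simp
    show "S = parity_ext ?x"
    proof (cases "n \<in> S")
      case True
      then have "card S = Suc (card (S - {n}))"
        using fin by (intro card.remove) auto
      then have "odd (card (S - {n}))"
        using \<open>even (card S)\<close> even_Suc by metis
      then show ?thesis
        unfolding ext using True by auto
    next
      case False
      then have "S - {n} = S"
        by simp
      with \<open>even (card S)\<close> show ?thesis
        unfolding ext by simp
    qed
  qed simp
qed

text \<open>Below \<open>n\<close> the symmetric difference consists of the coordinates where the
  words differ. Its size is even, so \<open>n\<close> is added exactly when the Hamming distance is
  odd: the distance is rounded up to an even number.\<close>

lemma card_sym_diff_parity_ext:
  assumes "length x = n" "length y = n"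
  shows "card (sym_diff (parity_ext x) (parity_ext y)) = 2 * ((hamming x y + 1) div 2)"
proof -
  let ?S = "sym_diff (parity_ext x) (parity_ext y)" and ?D = "{i. i < n \<and> x ! i \<noteq> y ! i}"
  have S: "?S \<in> even_subsets {..n}"
    using assms parity_ext_in[of x] parity_ext_in[of y] by (auto intro!: sym_diff_even_subsets)
  have D: "?D = ?S - {n}"
    using S assms parity_ext_less_iff[of _ x] parity_ext_less_iff[of _ y]
    by (auto simp: even_subsets_def)
  have "finite ?S"
    using S by (auto simp: even_subsets_def intro: finite_subset)
  then have "card ?S = (if n \<in> ?S then Suc (card ?D) else card ?D)"
    unfolding D using card.remove[of ?S n] by auto
  moreover have "even (card ?S)"
    using S by (simp add: even_subsets_def)
  ultimately show ?thesis
    using assms by (auto simp: hamming_def elim!: evenE split: if_splits)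
qed

lemma adj_square_hypercube_iff_parity_ext:
  assumes "length x = n" "length y = n"
  shows "adj (graph_square (hypercube n)) x y \<longleftrightarrow>
    card (sym_diff (parity_ext x) (parity_ext y)) = 2"
proof -
  have "hamming x y \<in> {1, 2} \<longleftrightarrow> 2 * ((hamming x y + 1) div 2) = 2"
    by auto
  with assms show ?thesis
    by (simp add: adj_square_hypercube_iff card_sym_diff_parity_ext)
qed

lemma obtain_parity_ext_sym_diff:
  assumes "length x = n" "S \<in> even_subsets {..n}"
  obtains y where "length y = n" "parity_ext y = sym_diff (parity_ext x) S"
proof -
  have "sym_diff (parity_ext x) S \<in> even_subsets {..n}"
    using assms parity_ext_in[of x] by (intro sym_diff_even_subsets) auto
  then have "sym_diff (parity_ext x) S \<in> parity_ext ` {y. length y = n}"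
    using bij_betw_parity_ext[of n] by (simp only: bij_betw_def)
  then show thesis
    using that by (metis (mono_tags, lifting) imageE mem_Collect_eq)
qed

lemma gdist_square_hypercube:
  assumes "length x = n" "length y = n"
  shows "gdist (graph_square (hypercube n)) x y = enat ((hamming x y + 1) div 2)"
  using assms
proof (intro gdist_eqI)
  fix x y :: "bool list" and k
  assume x: "x \<in> verts (graph_square (hypercube n))" and y: "y \<in> verts (graph_square (hypercube n))"
    and k: "(hamming x y + 1) div 2 = Suc k"
  let ?S = "sym_diff (parity_ext x) (parity_ext y)"
  have card: "card ?S = 2 * Suc k"
    using x y k by (simp add: card_sym_diff_parity_ext)
  \<comment> \<open>Toggling two of the elements in which \<open>x\<close> and \<open>y\<close>
    differ gives a neighbour \<open>z\<close> of \<open>x\<close> that is one step closer to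
    \<open>y\<close>.\<close>
  then obtain T where "T \<subseteq> ?S" and T: "card T = 2"
    by (metis obtain_subset_with_card_n le_add1 mult_Suc_right)
  moreover have "?S \<subseteq> {..n}"
    using x y parity_ext_in[of x] parity_ext_in[of y] by (auto simp: even_subsets_def)
  ultimately have "T \<in> even_subsets {..n}"
    by (auto simp: even_subsets_def)
  then obtain z where z: "length z = n" "parity_ext z = sym_diff (parity_ext x) T"
    using obtain_parity_ext_sym_diff[of x n T] x by auto
  have "sym_diff (parity_ext x) (parity_ext z) = T"
    "sym_diff (parity_ext z) (parity_ext y) = ?S - T"
    unfolding z(2) using \<open>T \<subseteq> ?S\<close> by blast+
  moreover have "card (?S - T) = 2 * k"
    using \<open>T \<subseteq> ?S\<close> T card by (subst card_Diff_subset) (auto intro: card_ge_0_finite)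
  ultimately have "adj (graph_square (hypercube n)) x z" "(hamming z y + 1) div 2 = k"
    using T x y z(1) card_sym_diff_parity_ext[of z n y]
    by (simp_all add: adj_square_hypercube_iff_parity_ext)
  with z(1) show "\<exists>z\<in>verts (graph_square (hypercube n)).
      adj (graph_square (hypercube n)) x z \<and> (hamming z y + 1) div 2 = k"
    by auto
next
  fix x y z :: "bool list"
  assume "x \<in> verts (graph_square (hypercube n))" "y \<in> verts (graph_square (hypercube n))"
  then have "hamming x z \<le> hamming x y + hamming y z"
    by (intro hamming_triangle) simp
  then show "(hamming x z + 1) div 2 \<le> (hamming x y + 1) div 2 + (hamming y z + 1) div 2"
    by linarith
next
  fix x y :: "bool list"
  assume "x \<in> verts (graph_square (hypercube n))" "y \<in> verts (graph_square (hypercube n))"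
  then show "(hamming x y + 1) div 2 = 0 \<longleftrightarrow> x = y"
    using hamming_eq_0_iff[of x y] by auto
qed (auto simp: adj_square_hypercube_iff)


section \<open>Distance-transitivity\<close>

lemma image_sym_diff:
  "inj_on p A \<Longrightarrow> S \<subseteq> A \<Longrightarrow> T \<subseteq> A \<Longrightarrow> p ` sym_diff S T = sym_diff (p ` S) (p ` T)"
  by (auto simp: inj_on_def)

lemma obtain_bij_betw_image_eq:
  assumes "finite A" "S \<subseteq> A" "T \<subseteq> A" "card S = card T"
  obtains p where "bij_betw p A A" "p ` S = T"
proof -
  have fin: "finite S" "finite T"
    using assms by (auto intro: finite_subset)
  then obtain h where h: "bij_betw h S T"
    using assms finite_same_card_bij by blast
  have "card (A - S) = card (A - T)"
    using assms fin by (simp add: card_Diff_subset)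
  then obtain k where k: "bij_betw k (A - S) (A - T)"
    using assms finite_same_card_bij[of "A - S" "A - T"] by auto
  let ?p = "\<lambda>x. if x \<in> S then h x else k x"
  have "bij_betw ?p S T"
    using h by (rule iffD2[OF bij_betw_cong, rotated]) simp
  moreover have "bij_betw ?p (A - S) (A - T)"
    using k by (rule iffD2[OF bij_betw_cong, rotated]) simp
  ultimately have "bij_betw ?p (S \<union> (A - S)) (T \<union> (A - T))"
    by (rule bij_betw_combine) auto
  moreover have "S \<union> (A - S) = A" "T \<union> (A - T) = A"
    using assms by auto
  moreover have "?p ` S = T"
    using h by (auto simp: bij_betw_def)
  ultimately show thesis
    using that by metis
qed

text \<open>Preserving sizes of symmetric differences makes \<open>g\<close> injective on the finite
  set of even subsets, hence a permutation of it. Conjugating with \<open>parity_ext\<close> gives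
  the automorphism.\<close>

lemma graph_aut_square_hypercubeI:
  assumes maps: "\<And>S. S \<in> even_subsets {..n} \<Longrightarrow> g S \<in> even_subsets {..n}"
    and card: "\<And>S T. S \<in> even_subsets {..n} \<Longrightarrow> T \<in> even_subsets {..n} \<Longrightarrow>
      card (sym_diff (g S) (g T)) = card (sym_diff S T)"
  obtains f where "f \<in> graph_auts (graph_square (hypercube n))"
    "\<And>x. length x = n \<Longrightarrow> parity_ext (f x) = g (parity_ext x)"
proof -
  let ?V = "{x :: bool list. length x = n}"
  let ?E = "even_subsets {..n}"
  have bij: "bij_betw parity_ext ?V ?E"
    by (rule bij_betw_parity_ext)
  have finS: "finite S" if "S \<in> ?E" for S
    using that by (auto simp: even_subsets_def intro: finite_subset)
  have "inj_on g ?E"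
  proof (rule inj_onI)
    fix S T assume ST: "S \<in> ?E" "T \<in> ?E" and "g S = g T"
    then have "card (sym_diff S T) = 0"
      using card[of S T] by simp
    then have "sym_diff S T = {}"
      using finS ST by (subst (asm) card_0_eq) auto
    then show "S = T"
      by auto
  qed
  moreover have "finite ?E"
    by (simp add: even_subsets_def)
  ultimately have "bij_betw g ?E ?E"
    using maps endo_inj_surj[of ?E g] by (auto simp: bij_betw_def)
  \<comment> \<open>The restriction makes \<open>f\<close> extensional, as membership in
    \<open>Bij\<close> requires.\<close>
  define f where "f = (\<lambda>x\<in>?V. inv_into ?V parity_ext (g (parity_ext x)))"
  have "bij_betw (inv_into ?V parity_ext \<circ> (g \<circ> parity_ext)) ?V ?V"
    using bij \<open>bij_betw g ?E ?E\<close> by (intro bij_betw_trans bij_betw_inv_into)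
  then have bij_f: "bij_betw f ?V ?V"
    by (rule iffD2[OF bij_betw_cong, rotated]) (simp add: f_def)
  have f: "parity_ext (f x) = g (parity_ext x)" if "length x = n" for x
    using that maps[of "parity_ext x"] parity_ext_in[of x] bij_betw_inv_into_right[OF bij]
    by (simp add: f_def)
  have len: "length (f x) = n" if "length x = n" for x
    using bij_f that by (auto simp: bij_betw_def)
  have "adj (graph_square (hypercube n)) (f x) (f y) \<longleftrightarrow> adj (graph_square (hypercube n)) x y"
    if "length x = n" "length y = n" for x y
    using that len parity_ext_in[of x] parity_ext_in[of y]
    by (simp add: adj_square_hypercube_iff_parity_ext f card)
  then have "graph_iso (graph_square (hypercube n)) (graph_square (hypercube n)) f"
    using bij_f by (simp add: graph_iso_def)
  then have "f \<in> graph_auts (graph_square (hypercube n))"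
    using bij_f by (simp add: graph_auts_def Bij_def f_def)
  with f that show thesis by blast
qed

lemma distance_transitive_square_hypercube:
  "distance_transitive (graph_square (hypercube n))"
  unfolding distance_transitive_def
proof (intro ballI impI)
  fix u v x y
  assume "u \<in> verts (graph_square (hypercube n))" "v \<in> verts (graph_square (hypercube n))"
    "x \<in> verts (graph_square (hypercube n))" "y \<in> verts (graph_square (hypercube n))"
    and dist: "gdist (graph_square (hypercube n)) u v = gdist (graph_square (hypercube n)) x y"
  then have len: "length u = n" "length v = n" "length x = n" "length y = n"
    by auto
  let ?E = "even_subsets {..n}"
  let ?e = parity_ext
  have E: "?e u \<in> ?E" "?e v \<in> ?E" "?e x \<in> ?E" "?e y \<in> ?E"
    using len parity_ext_in[of u] parity_ext_in[of v] parity_ext_in[of x] parity_ext_in[of y] by simp_all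
  then have sub: "sym_diff (?e v) (?e u) \<subseteq> {..n}" "sym_diff (?e y) (?e x) \<subseteq> {..n}"
    by (auto simp: even_subsets_def)
  \<comment> \<open>Distances are rounded-up halves of Hamming distances, which is exactly what
    determines the sizes of these sets.\<close>
  have "card (sym_diff (?e v) (?e u)) = card (sym_diff (?e y) (?e x))"
    using dist len by (simp add: gdist_square_hypercube card_sym_diff_parity_ext hamming_commute)
  then obtain p where p: "bij_betw p {..n} {..n}" and pS: "p ` sym_diff (?e v) (?e u) = sym_diff (?e y) (?e x)"
    using obtain_bij_betw_image_eq[OF _ sub] by auto
  have inj: "inj_on p {..n}" and surj: "p ` {..n} = {..n}"
    using p by (auto simp: bij_betw_def)
  \<comment> \<open>Translate the image of \<open>u\<close> to the empty set, permute the
    coordinates by \<open>p\<close>, and translate the empty set to the image of \<open>x\<close>.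
    The choice of \<open>p\<close> then sends the image of \<open>v\<close> to that of
    \<open>y\<close>.\<close>
  define g where "g S = sym_diff (p ` sym_diff S (?e u)) (?e x)" for S
  have "g S \<in> ?E" if "S \<in> ?E" for S
  proof -
    have "sym_diff S (?e u) \<in> ?E"
      using that E by (intro sym_diff_even_subsets) auto
    then have "p ` sym_diff S (?e u) \<in> ?E"
      using inj surj by (auto simp: even_subsets_def card_image[OF inj_on_subset])
    then show ?thesis
      unfolding g_def using E by (intro sym_diff_even_subsets) auto
  qed
  moreover have "card (sym_diff (g S) (g T)) = card (sym_diff S T)" if "S \<in> ?E" "T \<in> ?E" for S T
  proof -
    have sub': "sym_diff S (?e u) \<subseteq> {..n}" "sym_diff T (?e u) \<subseteq> {..n}" "sym_diff S T \<subseteq> {..n}"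
      using that E by (auto simp: even_subsets_def)
    have "sym_diff (g S) (g T) = sym_diff (p ` sym_diff S (?e u)) (p ` sym_diff T (?e u))"
      unfolding g_def by blast
    also have "\<dots> = p ` sym_diff (sym_diff S (?e u)) (sym_diff T (?e u))"
      using image_sym_diff[OF inj sub'(1,2)] by simp
    also have "sym_diff (sym_diff S (?e u)) (sym_diff T (?e u)) = sym_diff S T"
      by blast
    finally show ?thesis
      using card_image[OF inj_on_subset[OF inj sub'(3)]] by simp
  qed
  ultimately obtain f where f: "f \<in> graph_auts (graph_square (hypercube n))"
    "\<And>x. length x = n \<Longrightarrow> ?e (f x) = g (?e x)"
    using graph_aut_square_hypercubeI[of n g] by blast
  then have "f \<in> Bij {x. length x = n}"
    by (simp add: graph_auts_def)
  then have len_f: "length (f z) = n" if "length z = n" for z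
    using that Bij_imp_funcset by fastforce
  have "?e (f u) = ?e x"
    using f(2) len by (simp add: g_def)
  moreover have "?e (f v) = ?e y"
  proof -
    have "?e (f v) = sym_diff (sym_diff (?e y) (?e x)) (?e x)"
      using f(2)[OF len(2)] pS by (simp add: g_def)
    then show ?thesis by blast
  qed
  ultimately have "f u = x" "f v = y"
    using inj_onD[OF bij_betw_imp_inj_on[OF bij_betw_parity_ext[of n]]] len len_f by auto
  with f(1) show "\<exists>f\<in>graph_auts (graph_square (hypercube n)). f u = x \<and> f v = y"
    by blast
qed


section \<open>Primitivity\<close>

text \<open>The two vertices \<open>u\<close>, \<open>v\<close> of the block fix a distance
  \<open>i\<close>. The step from \<open>w\<close> to \<open>x\<close> is replaced by two steps of
  length \<open>i\<close> through a vertex \<open>z\<close>.\<close>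

lemma block_square_hypercube_closed_adj:
  assumes "even n"
    and block: "block (GraphAut (graph_square (hypercube n))) (verts (graph_square (hypercube n))) (\<lambda>f. f) B"
    and "u \<in> B" "v \<in> B" "u \<noteq> v" "w \<in> B" and adj: "adj (graph_square (hypercube n)) w x"
  shows "x \<in> B"
proof -
  let ?Q = "graph_square (hypercube n)" and ?e = parity_ext
  have "B \<subseteq> {x. length x = n}"
    using block by (simp add: block_def)
  then have len: "length u = n" "length v = n" "length w = n" "length x = n"
    using assms by (auto simp: adj_square_hypercube_iff)
  define i where "i = (hamming u v + 1) div 2"
  have i: "card (sym_diff (?e u) (?e v)) = 2 * i"
    unfolding i_def using len by (simp add: card_sym_diff_parity_ext)
  have "hamming u v \<noteq> 0"
    using len \<open>u \<noteq> v\<close> by (simp add: hamming_eq_0_iff)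
  moreover have "hamming u v \<le> n"
    unfolding hamming_def using card_mono[of "{..<n}" "{i. i < length u \<and> u ! i \<noteq> v ! i}"] len by auto
  \<comment> \<open>Here parity enters: rounding up a number that is at most the even number
    \<open>n\<close> to an even number does not exceed \<open>n\<close>.\<close>
  ultimately have "0 < i" "2 * i \<le> n"
    unfolding i_def using \<open>even n\<close> by (auto elim!: evenE)
  have "card (sym_diff (?e w) (?e x)) = 2"
    using adj len by (simp add: adj_square_hypercube_iff_parity_ext)
  then obtain a b where ab: "sym_diff (?e w) (?e x) = {a, b}" "a \<noteq> b"
    by (auto simp: card_2_iff)
  have "sym_diff (?e w) (?e x) \<subseteq> {..n}"
    using len parity_ext_in[of w] parity_ext_in[of x] by (auto simp: even_subsets_def)
  then have ab_le: "a \<le> n" "b \<le> n"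
    unfolding ab by auto
  then have "card ({..n} - {a, b}) = n - 1"
    using ab(2) by (subst card_Diff_subset) auto
  \<comment> \<open>Besides \<open>a\<close> and \<open>b\<close> there remain \<open>n - 1\<close>
    of the \<open>n + 1\<close> coordinates, enough for \<open>2 * i - 1\<close> elements. Toggling
    \<open>insert a S\<close> leads from \<open>w\<close> to \<open>z\<close>, and toggling
    \<open>insert b S\<close> from \<open>z\<close> to \<open>x\<close>, since together they toggle
    just \<open>a\<close> and \<open>b\<close>.\<close>
  then obtain S where S: "S \<subseteq> {..n} - {a, b}" "card S = 2 * i - 1"
    using \<open>2 * i \<le> n\<close> by (metis diff_le_mono obtain_subset_with_card_n)
  then have "finite S"
    by (auto intro: finite_subset)
  then have card: "card (insert a S) = 2 * i" "card (insert b S) = 2 * i"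
    using S \<open>0 < i\<close> by (auto simp: card_insert_if)
  then have "insert a S \<in> even_subsets {..n}"
    using S ab_le by (auto simp: even_subsets_def)
  then obtain z where z: "length z = n" "?e z = sym_diff (?e w) (insert a S)"
    using obtain_parity_ext_sym_diff len by blast
  have "sym_diff (?e w) (?e z) = insert a S"
    unfolding z by blast
  moreover have "sym_diff (?e z) (?e x) = sym_diff (sym_diff (?e w) (?e x)) (insert a S)"
    unfolding z by blast
  then have "sym_diff (?e z) (?e x) = insert b S"
    unfolding ab using S(1) ab(2) by blast
  ultimately have "(hamming w z + 1) div 2 = i" "(hamming z x + 1) div 2 = i"
    using card_sym_diff_parity_ext[of w n z] card_sym_diff_parity_ext[of z n x] len z(1) card by auto
  then have dist: "gdist ?Q w z = gdist ?Q u v" "gdist ?Q z x = gdist ?Q u v"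
    using len z(1) by (simp_all add: gdist_square_hypercube i_def)
  note closed = block_closed_gdist[OF distance_transitive_square_hypercube block \<open>u \<in> B\<close> \<open>v \<in> B\<close>]
  have "z \<in> B"
    by (rule closed[OF \<open>w \<in> B\<close> _ dist(1)]) (simp add: z(1))
  then show ?thesis
    by (rule closed[OF _ _ dist(2)]) (simp add: len)
qed

text \<open>This is connectedness: steps of Hamming distance 1 already reach every word.\<close>

lemma closed_adj_square_hypercube:
  assumes closed: "\<And>x y. x \<in> B \<Longrightarrow> adj (graph_square (hypercube n)) x y \<Longrightarrow> y \<in> B"
    and "x \<in> B" "length x = n" "length y = n"
  shows "y \<in> B"
  using assms(2,3)
proof (induction "hamming x y" arbitrary: x)
  case 0
  then show ?case
    using \<open>length y = n\<close> by (simp add: hamming_eq_0_iff)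
next
  case (Suc k)
  then obtain z where z: "length z = n" "hamming x z = 1" "hamming z y = k"
    using hamming_step[of x y k] \<open>length y = n\<close> by auto
  then have "z \<in> B"
    using closed Suc.prems by (auto simp: adj_square_hypercube_iff)
  with z Suc.hyps(1) show ?case by blast
qed

lemma primitive_square_hypercube:
  assumes "even n"
  shows "primitive_action (GraphAut (graph_square (hypercube n)))
    (verts (graph_square (hypercube n))) (\<lambda>f. f)"
  unfolding primitive_action_def
proof (intro conjI allI impI transitive_action_GraphAut distance_transitive_square_hypercube)
  fix B
  assume block: "block (GraphAut (graph_square (hypercube n))) (verts (graph_square (hypercube n))) (\<lambda>f. f) B"
  then have B: "B \<subseteq> verts (graph_square (hypercube n))"
    by (simp add: block_def)
  moreover have "finite (verts (graph_square (hypercube n)))"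
    using simple_graph_hypercube[of n] by (simp add: simple_graph_def)
  ultimately have "finite B"
    by (rule finite_subset)
  show "card B \<in> {0, 1, card (verts (graph_square (hypercube n)))}"
  proof (cases "card B \<le> Suc 0")
    case False
    then obtain u v where uv: "u \<in> B" "v \<in> B" "u \<noteq> v"
      using card_le_Suc0_iff_eq[OF \<open>finite B\<close>] by blast
    have "y \<in> B" if "length y = n" for y
      using closed_adj_square_hypercube[of B n u y]
        block_square_hypercube_closed_adj[OF assms block uv] uv(1) B that by auto
    then have "B = verts (graph_square (hypercube n))"
      using B by auto
    then show ?thesis by simp
  qed auto
qed

text \<open>For odd \<open>n\<close>, a Hamming distance below \<open>n\<close> has a strictly
  smaller rounded-up half, so the maximal distance is attained only by words that differ in every
  coordinate.\<close>

lemma gdist_square_hypercube_antipodal_iff: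
  assumes "odd n" "length x = n" "length y = n"
  shows "gdist (graph_square (hypercube n)) x y = enat ((n + 1) div 2) \<longleftrightarrow> y = map Not x"
proof -
  let ?D = "{i. i < length x \<and> x ! i \<noteq> y ! i}"
  have sub: "?D \<subseteq> {..<n}"
    using assms by auto
  then have "hamming x y \<le> n"
    unfolding hamming_def using card_mono[of "{..<n}" ?D] by simp
  then have "gdist (graph_square (hypercube n)) x y = enat ((n + 1) div 2) \<longleftrightarrow> card ?D = n"
    using assms by (auto simp: gdist_square_hypercube hamming_def elim!: oddE)
  also have "\<dots> \<longleftrightarrow> ?D = {..<n}"
    using card_subset_eq[OF finite_lessThan sub] by (metis card_lessThan)
  also have "\<dots> \<longleftrightarrow> (\<forall>i<n. y ! i = (\<not> x ! i))"
    unfolding set_eq_iff using assms(2) by (simp, blast)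
  also have "\<dots> \<longleftrightarrow> y = map Not x"
    using assms by (simp add: list_eq_iff_nth_eq)
  finally show ?thesis .
qed

text \<open>An antipodal pair is a block of size 2 among \<open>2 ^ n\<close> vertices. For
  \<open>n = 1\<close> it would be the whole vertex set.\<close>

lemma not_primitive_square_hypercube:
  assumes "odd n" "n \<noteq> 1"
  shows "\<not> primitive_action (GraphAut (graph_square (hypercube n)))
    (verts (graph_square (hypercube n))) (\<lambda>f. f)"
proof
  let ?Q = "graph_square (hypercube n)"
  assume prim: "primitive_action (GraphAut ?Q) (verts ?Q) (\<lambda>f. f)"
  define x where "x = replicate n True"
  define B where "B = {x, map Not x}"
  have len: "length x = n" by (simp add: x_def)
  have "B \<inter> f ` B \<in> {B, {}}" if "f \<in> graph_auts ?Q" for f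
  proof -
    have "graph_iso ?Q ?Q f" and bij: "bij_betw f {x. length x = n} {x. length x = n}"
      using that by (auto simp: graph_auts_def Bij_def)
    then have "gdist ?Q (f x) (f (map Not x)) = gdist ?Q x (map Not x)"
      using len by (intro gdist_graph_iso) auto
    also have "\<dots> = enat ((n + 1) div 2)"
      using \<open>odd n\<close> len by (subst gdist_square_hypercube_antipodal_iff) auto
    \<comment> \<open>Automorphisms preserve distances, so they map antipodes to antipodes.\<close>
    finally have "f (map Not x) = map Not (f x)"
      using bij len \<open>odd n\<close> by (subst (asm) gdist_square_hypercube_antipodal_iff) (auto simp: bij_betw_def)
    then have "f ` B = {f x, map Not (f x)}"
      by (simp add: B_def)
    moreover have invol: "map Not (map Not z) = z" for z
      by (simp add: comp_def)
    \<comment> \<open>Complementation is an involution, so two antipodal pairs that share a word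
      coincide.\<close>
    moreover have "map Not (f x) = x \<longleftrightarrow> f x = map Not x" "map Not (f x) = map Not x \<longleftrightarrow> f x = x"
      using invol by metis+
    ultimately show ?thesis
      unfolding B_def by (cases "f x = x \<or> f x = map Not x") (auto simp del: map_map)
  qed
  then have "block (GraphAut ?Q) (verts ?Q) (\<lambda>f. f) B"
    using len by (simp add: block_def GraphAut_def B_def)
  then have "card B \<in> {0, 1, card (verts ?Q)}"
    using prim by (simp add: primitive_action_def)
  moreover have "card (verts ?Q) = 2 ^ n"
    using card_lists_length_eq[of "UNIV :: bool set" n] by simp
  moreover have "x \<noteq> map Not x"
    using \<open>odd n\<close> by (cases n) (auto simp: x_def)
  then have "card B = 2"
    by (simp add: B_def)
  ultimately have "(2::nat) ^ n = 2 ^ 1"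
    by simp
  with \<open>n \<noteq> 1\<close> show False
    by (subst (asm) power_inject_exp) auto
qed


section \<open>Completeness and line graphs\<close>

text \<open>Characteristic words turn Hamming distances between explicit vertices into sizes of
  symmetric differences, which the simplifier can evaluate.\<close>

definition word_of :: "nat \<Rightarrow> nat set \<Rightarrow> bool list"
  where "word_of n S = map (\<lambda>i. i \<in> S) [0..<n]"

lemma length_word_of [simp]: "length (word_of n S) = n"
  by (simp add: word_of_def)

lemma hamming_word_of:
  assumes "S \<subseteq> {..<n}" "T \<subseteq> {..<n}"
  shows "hamming (word_of n S) (word_of n T) = card (sym_diff S T)"
proof -
  have "{i. i < length (word_of n S) \<and> word_of n S ! i \<noteq> word_of n T ! i} = sym_diff S T"
    using assms by (auto simp: word_of_def)
  then show ?thesis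
    by (simp add: hamming_def)
qed

lemma adj_word_of_iff:
  assumes "S \<subseteq> {..<n}" "T \<subseteq> {..<n}"
  shows "adj (graph_square (hypercube n)) (word_of n S) (word_of n T) \<longleftrightarrow>
    card (sym_diff S T) \<in> {1, 2}"
  using assms by (simp add: adj_square_hypercube_iff hamming_word_of)

text \<open>Two words at Hamming distance 3 are distinct and not adjacent.\<close>

lemma not_complete_square_hypercube:
  assumes "n \<ge> 3"
  shows "\<not> complete_graph (graph_square (hypercube n))"
proof
  assume "complete_graph (graph_square (hypercube n))"
  moreover have "hamming (word_of n {}) (word_of n {0, 1, 2}) = 3"
    using assms by (subst hamming_word_of) auto
  moreover from this have "word_of n {} \<noteq> word_of n {0, 1, 2}"
    using hamming_eq_0_iff[of "word_of n {}" "word_of n {0, 1, 2}"] by auto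
  ultimately show False
    by (force simp: complete_graph_def adj_square_hypercube_iff)
qed

text \<open>The halved cube on \<open>{0..4}\<close> has the five neighbours \<open>{0,1}, {2,3}, {4,0}, {1,2}, {3,4}\<close> of the
  empty set, which are cyclically disjoint. The words below arise by dropping the coordinate \<open>4\<close>.\<close>

lemma not_line_graph_square_hypercube:
  assumes "n \<ge> 4"
  shows "\<not> is_line_graph (graph_square (hypercube n))"
proof -
  \<comment> \<open>Distinctness of the five words is thereby reduced to a cardinality computation,
    like their adjacencies.\<close>
  have "word_of n S \<noteq> word_of n T" if "S \<subseteq> {..<n}" "T \<subseteq> {..<n}" "card (sym_diff S T) \<noteq> 0" for S T
    using that hamming_word_of[of S n T] hamming_eq_0_iff[of "word_of n S" "word_of n T"] by auto
  then show ?thesis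
    using assms
    by (intro not_is_line_graph_if_nonadj_pentagon[of "word_of n {}" _ "word_of n {0, 1}"
          "word_of n {2, 3}" "word_of n {0}" "word_of n {1, 2}" "word_of n {3}"])
      (simp_all add: adj_word_of_iff insert_Diff_if)
qed

theorem corollary4p4:
  fixes n :: nat
  assumes "n \<ge> 4"
  shows "automorphic_graph (graph_square (hypercube n)) \<longleftrightarrow> even n"
proof
  assume "even n"
  with assms show "automorphic_graph (graph_square (hypercube n))"
    by (simp add: automorphic_graph_def simple_graph_square simple_graph_hypercube
        distance_transitive_square_hypercube primitive_square_hypercube
        not_complete_square_hypercube not_line_graph_square_hypercube del: verts_graph_square)
next
  assume "automorphic_graph (graph_square (hypercube n))"
  with assms show "even n"
    using not_primitive_square_hypercube[of n] by (auto simp: automorphic_graph_def)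
qed

end
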